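(* Let $q$ be a prime power, $n\ge 1$, and let $C=\langle B_r\rangle\oplus\langle B_t\rangle\subseteq\mathbb{F}_q^n$ be an $\mathbb{F}_q$-linear code, where $B_r$ is an $r\times n$ matrix and $B_t$ a $t\times n$ matrix over $\mathbb{F}_q$, each with linearly independent rows, and $t=\dim_{\mathbb{F}_q}\langle B_t\rangle\ge 2$. Let $A$ be an invertible $t\times t$ matrix over $\mathbb{F}_q$ having no eigenvalue in $\mathbb{F}_q$, and let $D_A\subseteq\mathbb{F}_q^{2n}$ be the code defined below. Then $D_A$ gives rise to an EAQECC with parameters $[[n,\,n-2r-t+c',\,d';\,c']]_q$, i.e. $c(D_A)=c'$, $k(D_A)=n-2r-t+c'$ and $d(D_A)=d'$, where $$c'=\frac12\,\mathrm{rank}\begin{pmatrix} B_tB_t^TA^T-AB_tB_t^T & -AB_tB_r^T & B_tB_r^T\\ B_rB_t^TA^T & 0 & B_rB_r^T\\ -B_rB_t^T & -B_rB_r^T & 0\end{pmatrix},$$ and $d'\ge \min\left\{\delta_1,\left\lceil\left(1+\frac1q\right)\delta_2\right\rceil\right\}$ with $\delta_1=d_H(C^{\perp_e})$ and $\delta_2=d_H(\langle B_r\rangle^{\perp_e})$.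
   Context: $\mathbb{F}_q$ is the finite field with $q$ elements. For $x,y\in\mathbb{F}_q^n$, $x\cdot_e y=\sum_i x_iy_i$ is the Euclidean inner product and $V^{\perp_e}$ denotes the Euclidean dual of a subspace $V$. For a matrix $B$, $\langle B\rangle$ is the row space of $B$. $d_H(V)$ is the minimum Hamming weight of a nonzero vector of $V$. On $\mathbb{F}_q^{2n}$ the symplectic product is $(x|y)\cdot_s(z|w)=x\cdot_e w-z\cdot_e y$, and $D^{\perp_s}$ denotes the symplectic dual of $D$. The symplectic weight of $(x|y)$ is $\#\{j:(x_j,y_j)\ne(0,0)\}$ and for $S\subseteq\mathbb{F}_q^{2n}$, $d_s(S)$ is the minimum symplectic weight of a nonzero element of $S$. For an $\mathbb{F}_q$-linear code $D\subseteq\mathbb{F}_q^{2n}$, the EAQECC it gives rise to has parameters $[[n,k(D),d(D);c(D)]]_q$, where $c(D)=\frac12(\dim D-\dim(D\cap D^{\perp_s}))$, $k(D)=n-\dim D+c(D)$ and $d(D)=d_s\big(D^{\perp_s}\setminus(D\cap D^{\perp_s})\big)$. Given $C=\langle B_r\rangle\oplus\langle B_t\rangle$ as in the claim and an invertible $t\times t$ matrix $A$, $D_A\subseteq\mathbb{F}_q^{2n}$ is the $\mathbb{F}_q$-linear code generated by the rows of the matrix $\begin{pmatrix}B_t & AB_t\\ B_r & 0\\ 0 & B_r\end{pmatrix}$ (called a Steane enlargement of the EAQECC determined by $C$). *)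

theory Defs
  imports "Jordan_Normal_Form.Char_Poly" "Jordan_Normal_Form.DL_Rank" "HOL-Library.Extended_Nat"
begin

(* Vectors of F_q^m are 'a vec of dimension m; matrices are 'a mat (Jordan_Normal_Form). *)

(* row space <B>: all F-linear combinations of the rows of B *)
definition rowspace :: "'a::field mat \<Rightarrow> 'a vec set" where
  "rowspace B = {transpose_mat B *\<^sub>v c | c. c \<in> carrier_vec (dim_row B)}"

(* the rows of B are linearly independent *)
definition lin_indep_rows :: "'a::field mat \<Rightarrow> bool" where
  "lin_indep_rows B \<longleftrightarrow>
     (\<forall>c \<in> carrier_vec (dim_row B). transpose_mat B *\<^sub>v c = 0\<^sub>v (dim_col B) \<longrightarrow> c = 0\<^sub>v (dim_row B))"

(* dimension of a subspace W of F^m (library notion of vectorspace dimension) *)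
definition subdim :: "nat \<Rightarrow> 'a::field vec set \<Rightarrow> nat" where
  "subdim m W = vectorspace.dim class_ring ((module_vec TYPE('a) m)\<lparr>carrier := W\<rparr>)"

(* rank of a matrix (library notion) *)
definition mrank :: "'a::field mat \<Rightarrow> nat" where
  "mrank M = vec_space.rank (dim_row M) M"

(* horizontal concatenation (B | C) of two matrices with the same number of rows *)
definition hcat :: "'a::zero mat \<Rightarrow> 'a mat \<Rightarrow> 'a mat" where
  "hcat B C = four_block_mat B C (0\<^sub>m 0 (dim_col B)) (0\<^sub>m 0 (dim_col C))"

(* vertical concatenation: library append_rows *)
abbreviation vcat :: "'a::zero mat \<Rightarrow> 'a mat \<Rightarrow> 'a mat" where
  "vcat B C \<equiv> B @\<^sub>r C"

(* Euclidean dual in F^m *)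
definition edual :: "nat \<Rightarrow> 'a::field vec set \<Rightarrow> 'a vec set" where
  "edual m V = {w \<in> carrier_vec m. \<forall>v \<in> V. v \<bullet> w = 0}"

(* symplectic product on F^(2n): (x|y).(z|w) = x.w - z.y *)
definition symp :: "nat \<Rightarrow> 'a::field vec \<Rightarrow> 'a vec \<Rightarrow> 'a" where
  "symp n u v = vec_first u n \<bullet> vec_last v n - vec_first v n \<bullet> vec_last u n"

(* symplectic dual in F^(2n) *)
definition sdual :: "nat \<Rightarrow> 'a::field vec set \<Rightarrow> 'a vec set" where
  "sdual n D = {w \<in> carrier_vec (2 * n). \<forall>v \<in> D. symp n v w = 0}"

(* Hamming weight *)
definition hwt :: "'a::zero vec \<Rightarrow> nat" where
  "hwt v = card {j. j < dim_vec v \<and> v $ j \<noteq> 0}"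

(* symplectic weight of (x|y) in F^(2n) *)
definition swt :: "nat \<Rightarrow> 'a::zero vec \<Rightarrow> nat" where
  "swt n v = card {j. j < n \<and> (v $ j \<noteq> 0 \<or> v $ (n + j) \<noteq> 0)}"

(* minimum Hamming distance d_H(V) of V \<subseteq> F^m (infinity if V = {0}) *)
definition dH :: "nat \<Rightarrow> 'a::zero vec set \<Rightarrow> enat" where
  "dH m V = (INF v \<in> V - {0\<^sub>v m}. enat (hwt v))"

(* minimum symplectic weight d_s(S) of S \<subseteq> F^(2n) (infinity if no nonzero element) *)
definition ds :: "nat \<Rightarrow> 'a::zero vec set \<Rightarrow> enat" where
  "ds n S = (INF v \<in> S - {0\<^sub>v (2 * n)}. enat (swt n v))"

(* EAQECC parameters of a linear code D \<subseteq> F^(2n) *)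
definition ea_c :: "nat \<Rightarrow> 'a::field vec set \<Rightarrow> real" where
  "ea_c n D = (real (subdim (2 * n) D) - real (subdim (2 * n) (D \<inter> sdual n D))) / 2"

definition ea_k :: "nat \<Rightarrow> 'a::field vec set \<Rightarrow> real" where
  "ea_k n D = real n - real (subdim (2 * n) D) + ea_c n D"

definition ea_d :: "nat \<Rightarrow> 'a::field vec set \<Rightarrow> enat" where
  "ea_d n D = ds n (sdual n D - (D \<inter> sdual n D))"

(* generator matrix of the Steane enlargement D_A *)
definition steane_gen :: "'a::field mat \<Rightarrow> 'a mat \<Rightarrow> 'a mat \<Rightarrow> 'a mat" where
  "steane_gen Br Bt A =
     vcat (hcat Bt (A * Bt))
      (vcat (hcat Br (0\<^sub>m (dim_row Br) (dim_col Br)))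
            (hcat (0\<^sub>m (dim_row Br) (dim_col Br)) Br))"

(* the (t+2r) x (t+2r) matrix whose rank gives 2c' *)
definition steane_M :: "'a::field mat \<Rightarrow> 'a mat \<Rightarrow> 'a mat \<Rightarrow> 'a mat" where
  "steane_M Br Bt A =
    (let r = dim_row Br; t = dim_row Bt in
     vcat (hcat (hcat (Bt * transpose_mat Bt * transpose_mat A - A * Bt * transpose_mat Bt)
                      (- (A * Bt * transpose_mat Br)))
                (Bt * transpose_mat Br))
      (vcat (hcat (hcat (Br * transpose_mat Bt * transpose_mat A) (0\<^sub>m r r))
                  (Br * transpose_mat Br))
            (hcat (hcat (- (Br * transpose_mat Bt)) (- (Br * transpose_mat Br)))
                  (0\<^sub>m r r))))"

end

theory Submission
  imports Defs
begin

text \<open>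
  Write the generator matrix of \<open>D\<^sub>A\<close> as \<open>(G\<^sub>1 | G\<^sub>2)\<close> with
  \<open>G\<^sub>1 = (B\<^sub>t; B\<^sub>r; 0)\<close> and \<open>G\<^sub>2 = (A B\<^sub>t; 0; B\<^sub>r)\<close>. Its rows are
  independent, so \<open>dim D\<^sub>A = t + 2r\<close>. The symplectic product of rows \<open>i\<close> and \<open>j\<close>
  is the \<open>(i, j)\<close> entry of \<open>G\<^sub>1 G\<^sub>2\<^sup>T - G\<^sub>2 G\<^sub>1\<^sup>T\<close>, which is the
  matrix of the statement; so \<open>D\<^sub>A\<close> meets its symplectic dual in the image of the kernel
  of that matrix, of dimension \<open>t + 2r\<close> minus its rank. This gives \<open>c'\<close> and \<open>k\<close>.

  A nonzero \<open>(u | v)\<close> in the symplectic dual of \<open>D\<^sub>A\<close> satisfies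
  \<open>B\<^sub>r u = B\<^sub>r v = 0\<close> and \<open>B\<^sub>t v = A B\<^sub>t u\<close>. If \<open>B\<^sub>t u = 0\<close>, both \<open>u\<close>
  and \<open>v\<close> lie in the Euclidean dual of \<open>C\<close> and one of them is nonzero, so the symplectic
  weight is at least \<open>\<delta>\<^sub>1\<close>. Otherwise, since \<open>A\<close> has no eigenvalue in
  \<open>\<bbbF>\<^sub>q\<close>, the \<open>q + 1\<close> words \<open>u\<close> and \<open>v + \<lambda>u\<close>
  (\<open>\<lambda> \<in> \<bbbF>\<^sub>q\<close>) are nonzero words of the Euclidean dual of
  \<open>\<langle>B\<^sub>r\<rangle>\<close>; every coordinate in the support of \<open>(u | v)\<close> is nonzero in
  exactly \<open>q\<close> of them, so \<open>q \<cdot> swt (u | v) \<ge> (q + 1) \<delta>\<^sub>2\<close>.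
\<close>

section \<open>Vectors and block matrices\<close>

lemma minus_eq_zero_vec_iff:
  fixes a b :: "'a::ab_group_add vec"
  assumes "a \<in> carrier_vec n" and "b \<in> carrier_vec n"
  shows "a - b = 0\<^sub>v n \<longleftrightarrow> a = b"
  using assms by (auto simp: vec_eq_iff)

lemma dim_row_hcat[simp]: "dim_row (hcat X Y) = dim_row X"
  unfolding hcat_def by simp

lemma dim_col_hcat[simp]: "dim_col (hcat X Y) = dim_col X + dim_col Y"
  unfolding hcat_def by auto

lemma dim_append_rows[simp]:
  "dim_row (X @\<^sub>r Y) = dim_row X + dim_row Y" "dim_col (X @\<^sub>r Y) = dim_col X"
  unfolding append_rows_def by auto

lemma index_hcat[simp]:
  "i < dim_row X \<Longrightarrow> j < dim_col X + dim_col Y \<Longrightarrow>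
    hcat X Y $$ (i, j) = (if j < dim_col X then X $$ (i, j) else Y $$ (i, j - dim_col X))"
  unfolding hcat_def by simp

lemma index_append_rows[simp]:
  "i < dim_row X + dim_row Y \<Longrightarrow> j < dim_col X \<Longrightarrow>
    (X @\<^sub>r Y) $$ (i, j) = (if i < dim_row X then X $$ (i, j) else Y $$ (i - dim_row X, j))"
  unfolding append_rows_def by simp

lemma carrier_hcat:
  "X \<in> carrier_mat m n1 \<Longrightarrow> Y \<in> carrier_mat m n2 \<Longrightarrow> hcat X Y \<in> carrier_mat m (n1 + n2)"
  unfolding hcat_def by auto

lemma row_append_rows:
  "dim_col X = dim_col Y \<Longrightarrow> i < dim_row X + dim_row Y \<Longrightarrow>
    row (X @\<^sub>r Y) i = (if i < dim_row X then row X i else row Y (i - dim_row X))"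
  by (rule eq_vecI) auto

lemma append_rows_hcat:
  assumes "X1 \<in> carrier_mat r1 n1" "X2 \<in> carrier_mat r1 n2"
    and "Y1 \<in> carrier_mat r2 n1" "Y2 \<in> carrier_mat r2 n2"
  shows "hcat X1 X2 @\<^sub>r hcat Y1 Y2 = hcat (X1 @\<^sub>r Y1) (X2 @\<^sub>r Y2)"
  by (rule eq_matI) (use assms in auto)

lemma transpose_hcat:
  assumes "G1 \<in> carrier_mat m n1" and "G2 \<in> carrier_mat m n2"
  shows "(hcat G1 G2)\<^sup>T = G1\<^sup>T @\<^sub>r G2\<^sup>T"
  using assms unfolding hcat_def append_rows_def by (subst transpose_four_block_mat) auto

lemma hcat_transpose_mult_vec:
  fixes G1 G2 :: "'a::field mat"
  assumes "G1 \<in> carrier_mat m n1" and "G2 \<in> carrier_mat m n2" and "c \<in> carrier_vec m"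
  shows "(hcat G1 G2)\<^sup>T *\<^sub>v c = (G1\<^sup>T *\<^sub>v c) @\<^sub>v (G2\<^sup>T *\<^sub>v c)"
  using assms by (simp add: transpose_hcat mat_mult_append)

lemma transpose_append_rows_mult_append_vec:
  fixes X Y :: "'a::comm_semiring_0 mat"
  assumes dims: "dim_col X = dim_col Y" "dim_vec a = dim_row X" "dim_vec b = dim_row Y"
  shows "(X @\<^sub>r Y)\<^sup>T *\<^sub>v (a @\<^sub>v b) = X\<^sup>T *\<^sub>v a + Y\<^sup>T *\<^sub>v b"
proof (rule eq_vecI)
  fix j assume "j < dim_vec (X\<^sup>T *\<^sub>v a + Y\<^sup>T *\<^sub>v b)"
  then have j: "j < dim_col X" using dims by simp
  have "col (X @\<^sub>r Y) j = col X j @\<^sub>v col Y j"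
    by (rule eq_vecI) (use dims j in auto)
  moreover have "col X j \<bullet> a + col Y j \<bullet> b = (col X j @\<^sub>v col Y j) \<bullet> (a @\<^sub>v b)"
    by (rule scalar_prod_append[symmetric]) (use dims in \<open>auto intro: carrier_vecI\<close>)
  ultimately show "((X @\<^sub>r Y)\<^sup>T *\<^sub>v (a @\<^sub>v b)) $ j = (X\<^sup>T *\<^sub>v a + Y\<^sup>T *\<^sub>v b) $ j"
    using dims j by simp
qed (use dims in simp)

lemma vec_first_append: "v \<in> carrier_vec n \<Longrightarrow> vec_first (v @\<^sub>v w) n = v"
  by (rule eq_vecI) (auto simp: vec_first_def)

lemma vec_last_append: "w \<in> carrier_vec n \<Longrightarrow> vec_last (v @\<^sub>v w) n = w"
  by (rule eq_vecI) (auto simp: vec_last_def)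

lemma zero_vec_add_eq_append: "0\<^sub>v (n1 + n2) = (0\<^sub>v n1 @\<^sub>v 0\<^sub>v n2 :: 'a::zero vec)"
  by (rule eq_vecI) auto

lemma zero_mat_mult_vec: "v \<in> carrier_vec n \<Longrightarrow> 0\<^sub>m m n *\<^sub>v v = (0\<^sub>v m :: 'a::semiring_0 vec)"
  by (rule eq_vecI) auto

lemma mult_mat_vec_zero: "A \<in> carrier_mat m n \<Longrightarrow> A *\<^sub>v 0\<^sub>v n = (0\<^sub>v m :: 'a::semiring_0 vec)"
  by (rule eq_vecI) auto

lemma rowspace_eq_image: "rowspace B = (*\<^sub>v) B\<^sup>T ` carrier_vec (dim_row B)"
  unfolding rowspace_def by auto

lemma rowspace_subset_carrier: "B \<in> carrier_mat k n \<Longrightarrow> rowspace B \<subseteq> carrier_vec n"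
  unfolding rowspace_eq_image by auto

lemma lin_indep_rows_append_rows:
  fixes X Y :: "'a::field mat"
  assumes X: "X \<in> carrier_mat r1 n" and Y: "Y \<in> carrier_mat r2 n"
    and indep_X: "lin_indep_rows X" and indep_Y: "lin_indep_rows Y"
    and disjoint: "rowspace X \<inter> rowspace Y = {0\<^sub>v n}"
  shows "lin_indep_rows (X @\<^sub>r Y)"
  unfolding lin_indep_rows_def
proof (intro ballI impI)
  fix c :: "'a vec" assume "c \<in> carrier_vec (dim_row (X @\<^sub>r Y))"
  then obtain a b where a: "a \<in> carrier_vec r1" and b: "b \<in> carrier_vec r2" and c: "c = a @\<^sub>v b"
    using X Y by (metis carrier_matD(1) dim_append_rows(1) vec_first_carrier vec_last_carrier
        vec_first_last_append)
  assume "(X @\<^sub>r Y)\<^sup>T *\<^sub>v c = 0\<^sub>v (dim_col (X @\<^sub>r Y))"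
  then have sum: "X\<^sup>T *\<^sub>v a + Y\<^sup>T *\<^sub>v b = 0\<^sub>v n"
    using a b
    by (simp add: c transpose_append_rows_mult_append_vec carrier_matD[OF X] carrier_matD[OF Y])
  then have "X\<^sup>T *\<^sub>v a = Y\<^sup>T *\<^sub>v (- b)"
    using X Y a b by (auto simp: vec_eq_iff eq_neg_iff_add_eq_0)
  then have "X\<^sup>T *\<^sub>v a \<in> rowspace X \<inter> rowspace Y"
    using X Y a b unfolding rowspace_eq_image
    by (metis IntI carrier_matD(1) image_eqI uminus_carrier_vec)
  then have Xa: "X\<^sup>T *\<^sub>v a = 0\<^sub>v n" using disjoint by blast
  then have "Y\<^sup>T *\<^sub>v b = 0\<^sub>v n" using sum Y b by simp
  with Xa have "a = 0\<^sub>v r1" "b = 0\<^sub>v r2"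
    using indep_X indep_Y X Y a b unfolding lin_indep_rows_def by auto
  then show "c = 0\<^sub>v (dim_row (X @\<^sub>r Y))"
    using X Y unfolding c by (auto simp: vec_eq_iff)
qed

section \<open>Dimensions of subspaces\<close>

lemma finite_carrier_vec: "finite (carrier_vec m :: 'a::finite vec set)"
proof -
  have "carrier_vec m \<subseteq> vec_of_list ` {xs :: 'a list. set xs \<subseteq> UNIV \<and> length xs = m}"
  proof
    fix v :: "'a vec" assume "v \<in> carrier_vec m"
    then show "v \<in> vec_of_list ` {xs. set xs \<subseteq> UNIV \<and> length xs = m}"
      by (intro image_eqI[of _ _ "list_of_vec v"]) (auto simp: vec_list)
  qed
  moreover have "finite {xs :: 'a list. set xs \<subseteq> UNIV \<and> length xs = m}"
    by (rule finite_lists_length_eq) simp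
  ultimately show ?thesis by (metis finite_surj)
qed

lemma vectorspace_fin_dim_if_finite_carrier:
  assumes "vectorspace K V" and "finite (carrier V)"
  shows "vectorspace.fin_dim K V"
proof -
  interpret vectorspace K V by fact
  show ?thesis unfolding fin_dim_def
    using span_is_subset2 in_own_span assms(2) by (intro exI[of _ "carrier V"]) auto
qed

lemma subspace_carrier_vec: "subspace class_ring (carrier_vec m) (module_vec TYPE('a::field) m)"
  unfolding subspace_def submodule_def using vec_vs[of m] vec_module[of m]
  by (auto simp: module_vec_simps class_ring_simps)

lemma linear_map_mult_mat_vec:
  fixes L :: "'a::field mat"
  assumes L: "L \<in> carrier_mat N m" and K: "subspace class_ring K (module_vec TYPE('a) m)"
  shows "linear_map class_ring ((module_vec TYPE('a) m)\<lparr>carrier := K\<rparr>) (module_vec TYPE('a) N)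
           ((*\<^sub>v) L)"
proof -
  interpret V: vec_space "TYPE('a)" m .
  have "vectorspace class_ring ((module_vec TYPE('a) m)\<lparr>carrier := K\<rparr>)"
    using V.subspace_is_vs[OF K] by simp
  moreover have "K \<subseteq> carrier_vec m" using K unfolding subspace_def submodule_def by auto
  ultimately show ?thesis
    unfolding linear_map_def mod_hom_def mod_hom_axioms_def module_hom_def
    using vec_vs[of N] L
    by (auto simp: vectorspace_def module_vec_simps class_ring_simps mult_mat_vec
        intro!: mult_add_distrib_mat_vec[OF L])
qed

lemma subspace_mat_kernel:
  fixes M :: "'a::field mat"
  assumes "M \<in> carrier_mat N m"
  shows "subspace class_ring {c \<in> carrier_vec m. M *\<^sub>v c = 0\<^sub>v N} (module_vec TYPE('a) m)"
proof -
  interpret lm: linear_map class_ring "(module_vec TYPE('a) m)\<lparr>carrier := carrier_vec m\<rparr>"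
    "module_vec TYPE('a) N" "(*\<^sub>v) M"
    by (rule linear_map_mult_mat_vec[OF assms subspace_carrier_vec])
  from lm.kerT_is_subspace show ?thesis
    unfolding lm.ker_def by (simp add: module_vec_def)
qed

lemma subdim_carrier_vec: "subdim m (carrier_vec m :: 'a::field vec set) = m"
proof -
  interpret vec_space "TYPE('a)" m .
  show ?thesis using dim_is_n unfolding subdim_def by (simp add: module_vec_def)
qed

lemma subdim_image_plus_subdim_kernel:
  fixes L :: "'a::{finite,field} mat"
  assumes L: "L \<in> carrier_mat N m" and K: "subspace class_ring K (module_vec TYPE('a) m)"
  shows "subdim N ((*\<^sub>v) L ` K) + subdim m {c \<in> K. L *\<^sub>v c = 0\<^sub>v N} = subdim m K"
proof -
  interpret lm: linear_map class_ring "(module_vec TYPE('a) m)\<lparr>carrier := K\<rparr>"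
    "module_vec TYPE('a) N" "(*\<^sub>v) L"
    by (rule linear_map_mult_mat_vec[OF L K])
  interpret V: vec_space "TYPE('a)" m .
  have "K \<subseteq> carrier_vec m" using K unfolding subspace_def submodule_def by auto
  then have "lm.V.fin_dim"
    by (intro vectorspace_fin_dim_if_finite_carrier V.subspace_is_vs[OF K])
      (simp add: finite_subset[OF _ finite_carrier_vec])
  from lm.rank_nullity[OF this] show ?thesis
    unfolding subdim_def lm.im_def lm.ker_def by (simp add: module_vec_simps)
qed

lemma subdim_image_inj:
  fixes L :: "'a::{finite,field} mat"
  assumes L: "L \<in> carrier_mat N m" and K: "subspace class_ring K (module_vec TYPE('a) m)"
    and inj: "inj_on ((*\<^sub>v) L) K"
  shows "subdim N ((*\<^sub>v) L ` K) = subdim m K"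
proof -
  interpret lm: linear_map class_ring "(module_vec TYPE('a) m)\<lparr>carrier := K\<rparr>"
    "module_vec TYPE('a) N" "(*\<^sub>v) L"
    by (rule linear_map_mult_mat_vec[OF L K])
  have "subdim m {c \<in> K. L *\<^sub>v c = 0\<^sub>v N} = 0"
    using lm.inj_imp_dim_ker0 inj unfolding subdim_def lm.ker_def by (simp add: module_vec_simps)
  then show ?thesis using subdim_image_plus_subdim_kernel[OF L K] by simp
qed

lemma mrank_plus_subdim_kernel:
  fixes M :: "'a::{finite,field} mat"
  assumes M: "M \<in> carrier_mat N m"
  shows "mrank M + subdim m {c \<in> carrier_vec m. M *\<^sub>v c = 0\<^sub>v N} = m"
proof -
  interpret V: vec_space "TYPE('a)" N .
  have "V.span (set (cols M)) = (*\<^sub>v) M ` carrier_vec m"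
    using V.col_space_eq[OF M] M unfolding V.col_space_def by auto
  moreover have "mrank M = V.rank M" using M by (simp add: mrank_def)
  ultimately have "mrank M = subdim N ((*\<^sub>v) M ` carrier_vec m)"
    unfolding subdim_def V.rank_def by simp
  then show ?thesis
    using subdim_image_plus_subdim_kernel[OF M subspace_carrier_vec]
    by (simp add: subdim_carrier_vec)
qed

lemma inj_on_lin_indep_rows:
  fixes B :: "'a::field mat"
  assumes B: "B \<in> carrier_mat m N" and indep: "lin_indep_rows B"
  shows "inj_on ((*\<^sub>v) B\<^sup>T) (carrier_vec m)"
proof (rule inj_onI)
  fix a b :: "'a vec" assume a: "a \<in> carrier_vec m" and b: "b \<in> carrier_vec m"
    and eq: "B\<^sup>T *\<^sub>v a = B\<^sup>T *\<^sub>v b"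
  have "B\<^sup>T *\<^sub>v (a - b) = B\<^sup>T *\<^sub>v a - B\<^sup>T *\<^sub>v b"
    using B a b by (simp add: mult_minus_distrib_mat_vec)
  also have "\<dots> = 0\<^sub>v N" unfolding eq using B b by (intro minus_cancel_vec) auto
  finally have "a - b = 0\<^sub>v m" using indep B a b unfolding lin_indep_rows_def by auto
  then show "a = b" using a b by (simp add: minus_eq_zero_vec_iff)
qed

lemma subdim_rowspace:
  fixes B :: "'a::{finite,field} mat"
  assumes B: "B \<in> carrier_mat m N" and indep: "lin_indep_rows B"
  shows "subdim N (rowspace B) = m"
  unfolding rowspace_eq_image
  using subdim_image_inj[OF _ subspace_carrier_vec inj_on_lin_indep_rows[OF B indep]] B
  by (simp add: subdim_carrier_vec)

section \<open>Codes with generator matrix \<open>(G\<^sub>1 | G\<^sub>2)\<close>\<close>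

lemma symp_hcat_transpose_mult_vec:
  fixes G1 G2 :: "'a::field mat"
  assumes G1: "G1 \<in> carrier_mat m n" and G2: "G2 \<in> carrier_mat m n"
    and c: "c \<in> carrier_vec m" and w: "w \<in> carrier_vec (2 * n)"
  shows "symp n ((hcat G1 G2)\<^sup>T *\<^sub>v c) w = c \<bullet> (G1 *\<^sub>v vec_last w n - G2 *\<^sub>v vec_first w n)"
proof -
  have "symp n ((hcat G1 G2)\<^sup>T *\<^sub>v c) w
      = (G1\<^sup>T *\<^sub>v c) \<bullet> vec_last w n - vec_first w n \<bullet> (G2\<^sup>T *\<^sub>v c)"
    using G1 G2 c
    by (simp add: symp_def hcat_transpose_mult_vec vec_first_append vec_last_append)
  also have "vec_first w n \<bullet> (G2\<^sup>T *\<^sub>v c) = (G2\<^sup>T *\<^sub>v c) \<bullet> vec_first w n"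
    using G2 by (intro comm_scalar_prod[of _ n] carrier_vecI) auto
  also have "(G2\<^sup>T *\<^sub>v c) \<bullet> vec_first w n = c \<bullet> (G2 *\<^sub>v vec_first w n)"
    by (rule transpose_vec_mult_scalar[OF G2 _ c]) simp
  also have "(G1\<^sup>T *\<^sub>v c) \<bullet> vec_last w n = c \<bullet> (G1 *\<^sub>v vec_last w n)"
    by (rule transpose_vec_mult_scalar[OF G1 _ c]) simp
  finally show ?thesis
    using G1 G2 by (simp add: scalar_prod_minus_distrib[OF c])
qed

lemma scalar_prod_all_zero_iff:
  fixes v :: "'a::comm_ring_1 vec"
  assumes "v \<in> carrier_vec m"
  shows "(\<forall>c \<in> carrier_vec m. c \<bullet> v = 0) \<longleftrightarrow> v = 0\<^sub>v m"
proof
  assume "\<forall>c \<in> carrier_vec m. c \<bullet> v = 0"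
  then have "unit_vec m i \<bullet> v = 0" if "i < m" for i by simp
  then show "v = 0\<^sub>v m" using assms by (intro eq_vecI) auto
qed (use assms in auto)

lemma mem_sdual_rowspace_hcat_iff:
  fixes G1 G2 :: "'a::field mat"
  assumes G1: "G1 \<in> carrier_mat m n" and G2: "G2 \<in> carrier_mat m n"
  shows "w \<in> sdual n (rowspace (hcat G1 G2)) \<longleftrightarrow>
    w \<in> carrier_vec (2 * n) \<and> G1 *\<^sub>v vec_last w n = G2 *\<^sub>v vec_first w n"
proof (cases "w \<in> carrier_vec (2 * n)")
  case True
  have "w \<in> sdual n (rowspace (hcat G1 G2)) \<longleftrightarrow>
      (\<forall>c \<in> carrier_vec m. c \<bullet> (G1 *\<^sub>v vec_last w n - G2 *\<^sub>v vec_first w n) = 0)"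
    using G1 True
    by (simp add: sdual_def rowspace_eq_image symp_hcat_transpose_mult_vec[OF G1 G2 _ True])
  also have "\<dots> \<longleftrightarrow> G1 *\<^sub>v vec_last w n - G2 *\<^sub>v vec_first w n = 0\<^sub>v m"
    using G1 G2 by (intro scalar_prod_all_zero_iff) auto
  also have "\<dots> \<longleftrightarrow> G1 *\<^sub>v vec_last w n = G2 *\<^sub>v vec_first w n"
    using G1 G2 by (intro minus_eq_zero_vec_iff) auto
  finally show ?thesis using True by simp
qed (simp add: sdual_def)

lemma rowspace_hcat_inter_sdual:
  fixes G1 G2 :: "'a::field mat"
  assumes G1: "G1 \<in> carrier_mat m n" and G2: "G2 \<in> carrier_mat m n"
  defines "D \<equiv> rowspace (hcat G1 G2)"
  shows "D \<inter> sdual n D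
    = (*\<^sub>v) (hcat G1 G2)\<^sup>T ` {c \<in> carrier_vec m. (G1 * G2\<^sup>T - G2 * G1\<^sup>T) *\<^sub>v c = 0\<^sub>v m}"
proof -
  have "(hcat G1 G2)\<^sup>T *\<^sub>v c \<in> sdual n D \<longleftrightarrow> (G1 * G2\<^sup>T - G2 * G1\<^sup>T) *\<^sub>v c = 0\<^sub>v m"
    if c: "c \<in> carrier_vec m" for c
  proof -
    have "(G1 * G2\<^sup>T - G2 * G1\<^sup>T) *\<^sub>v c = G1 *\<^sub>v (G2\<^sup>T *\<^sub>v c) - G2 *\<^sub>v (G1\<^sup>T *\<^sub>v c)"
      using G1 G2 c
      by (simp add: minus_mult_distrib_mat_vec[of _ m m] assoc_mult_mat_vec[of _ m n _ m])
    then have "(G1 * G2\<^sup>T - G2 * G1\<^sup>T) *\<^sub>v c = 0\<^sub>v m \<longleftrightarrow> G1 *\<^sub>v (G2\<^sup>T *\<^sub>v c) = G2 *\<^sub>v (G1\<^sup>T *\<^sub>v c)"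
      using G1 G2 by (simp add: minus_eq_zero_vec_iff[of _ m] carrier_vecI)
    then show ?thesis
      using G1 G2 c unfolding D_def mem_sdual_rowspace_hcat_iff[OF G1 G2]
      by (simp add: hcat_transpose_mult_vec vec_first_append vec_last_append mult_2)
  qed
  moreover have "D = (*\<^sub>v) (hcat G1 G2)\<^sup>T ` carrier_vec m"
    using G1 unfolding D_def rowspace_eq_image by simp
  ultimately show ?thesis by auto
qed

lemma subdim_rowspace_hcat_inter_sdual:
  fixes G1 G2 :: "'a::{finite,field} mat"
  assumes G1: "G1 \<in> carrier_mat m n" and G2: "G2 \<in> carrier_mat m n"
    and indep: "lin_indep_rows (hcat G1 G2)"
  defines "D \<equiv> rowspace (hcat G1 G2)"
  shows "subdim (2 * n) (D \<inter> sdual n D) + mrank (G1 * G2\<^sup>T - G2 * G1\<^sup>T) = m"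
proof -
  let ?M = "G1 * G2\<^sup>T - G2 * G1\<^sup>T"
  let ?K = "{c \<in> carrier_vec m. ?M *\<^sub>v c = 0\<^sub>v m}"
  have H: "hcat G1 G2 \<in> carrier_mat m (n + n)" by (rule carrier_hcat[OF G1 G2])
  have M: "?M \<in> carrier_mat m m" using G1 G2 by auto
  have "subdim (n + n) ((*\<^sub>v) (hcat G1 G2)\<^sup>T ` ?K) = subdim m ?K"
    using H subspace_mat_kernel[OF M]
      inj_on_subset[OF inj_on_lin_indep_rows[OF H indep], of ?K]
    by (intro subdim_image_inj) auto
  then show ?thesis
    using mrank_plus_subdim_kernel[OF M] rowspace_hcat_inter_sdual[OF G1 G2]
    unfolding D_def mult_2 by simp
qed

lemma ea_c_rowspace_hcat:
  fixes G1 G2 :: "'a::{finite,field} mat"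
  assumes G1: "G1 \<in> carrier_mat m n" and G2: "G2 \<in> carrier_mat m n"
    and indep: "lin_indep_rows (hcat G1 G2)"
  shows "ea_c n (rowspace (hcat G1 G2)) = real (mrank (G1 * G2\<^sup>T - G2 * G1\<^sup>T)) / 2"
proof -
  have "subdim (2 * n) (rowspace (hcat G1 G2)) = m"
    using subdim_rowspace[OF carrier_hcat[OF G1 G2] indep] by (simp add: mult_2)
  then show ?thesis
    using subdim_rowspace_hcat_inter_sdual[OF G1 G2 indep] unfolding ea_c_def
    by (simp add: field_simps flip: of_nat_add)
qed

lemma ea_k_rowspace_hcat:
  fixes G1 G2 :: "'a::{finite,field} mat"
  assumes G1: "G1 \<in> carrier_mat m n" and G2: "G2 \<in> carrier_mat m n"
    and indep: "lin_indep_rows (hcat G1 G2)"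
  shows "ea_k n (rowspace (hcat G1 G2)) = real n - real m + real (mrank (G1 * G2\<^sup>T - G2 * G1\<^sup>T)) / 2"
  using subdim_rowspace[OF carrier_hcat[OF G1 G2] indep] ea_c_rowspace_hcat[OF G1 G2 indep]
  unfolding ea_k_def by (simp add: mult_2)

section \<open>The Steane enlargement\<close>

lemma steane_gen_eq_hcat:
  fixes Br Bt A :: "'a::field mat"
  assumes Br: "Br \<in> carrier_mat r n" and Bt: "Bt \<in> carrier_mat t n" and A: "A \<in> carrier_mat t t"
  shows "steane_gen Br Bt A = hcat (Bt @\<^sub>r Br @\<^sub>r 0\<^sub>m r n) (A * Bt @\<^sub>r 0\<^sub>m r n @\<^sub>r Br)"
  using Br Bt A unfolding steane_gen_def
  by (simp add: append_rows_hcat[of _ r n _ n _ r] append_rows_hcat[of _ t n _ n _ "r + r"])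

lemma steane_M_eq_symplectic_gram:
  fixes Br Bt A :: "'a::field mat"
  assumes Br: "Br \<in> carrier_mat r n" and Bt: "Bt \<in> carrier_mat t n" and A: "A \<in> carrier_mat t t"
  defines "G1 \<equiv> Bt @\<^sub>r Br @\<^sub>r 0\<^sub>m r n" and "G2 \<equiv> A * Bt @\<^sub>r 0\<^sub>m r n @\<^sub>r Br"
  shows "steane_M Br Bt A = G1 * G2\<^sup>T - G2 * G1\<^sup>T"
proof -
  define AB where "AB = A * Bt"
  have AB: "AB \<in> carrier_mat t n" unfolding AB_def using A Bt by simp
  have G1: "G1 \<in> carrier_mat (t + (r + r)) n" and G2: "G2 \<in> carrier_mat (t + (r + r)) n"
    unfolding G1_def G2_def AB_def[symmetric] using Br Bt AB by auto
  have row_G1: "row G1 i = (if i < t then row Bt i else if i < t + r then row Br (i - t) else 0\<^sub>v n)"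
    and row_G2: "row G2 i =
      (if i < t then row AB i else if i < t + r then 0\<^sub>v n else row Br (i - t - r))"
    if "i < t + (r + r)" for i
    using that Br Bt AB unfolding G1_def G2_def AB_def[symmetric]
    by (auto simp: row_append_rows intro!: eq_vecI)
  have row_in_carrier: "row X k \<in> carrier_vec n"
    if "X \<in> carrier_mat k' n" for X :: "'a mat" and k k'
    using that by (simp add: carrier_vecI)
  have "Bt * Bt\<^sup>T * A\<^sup>T = Bt * AB\<^sup>T" "Br * Bt\<^sup>T * A\<^sup>T = Br * AB\<^sup>T"
    unfolding AB_def using A Bt Br
    by (simp_all add: transpose_mult[OF A Bt] assoc_mult_mat[of _ _ n _ t _ t])
  then have entry: "steane_M Br Bt A $$ (i, j) = row G1 i \<bullet> row G2 j - row G2 i \<bullet> row G1 j"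
    if i: "i < t + (r + r)" and j: "j < t + (r + r)" for i j
    unfolding steane_M_def Let_def AB_def[symmetric]
      row_G1[OF i] row_G1[OF j] row_G2[OF i] row_G2[OF j]
    using i j Br Bt AB
    by (cases "i < t"; cases "i < t + r"; cases "j < t"; cases "j < t + r")
      (auto simp: row_in_carrier)
  show ?thesis
  proof (rule eq_matI)
    fix i j assume "i < dim_row (G1 * G2\<^sup>T - G2 * G1\<^sup>T)" "j < dim_col (G1 * G2\<^sup>T - G2 * G1\<^sup>T)"
    with G1 G2 show "steane_M Br Bt A $$ (i, j) = (G1 * G2\<^sup>T - G2 * G1\<^sup>T) $$ (i, j)"
      by (simp add: entry)
  qed (use G1 G2 Br Bt A in \<open>simp_all add: steane_M_def Let_def\<close>)
qed

lemma steane_gen_transpose_mult_vec: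
  fixes Br Bt A :: "'a::field mat"
  assumes Br: "Br \<in> carrier_mat r n" and Bt: "Bt \<in> carrier_mat t n" and A: "A \<in> carrier_mat t t"
    and a: "a \<in> carrier_vec t" and b: "b \<in> carrier_vec r" and d: "d \<in> carrier_vec r"
  shows "(steane_gen Br Bt A)\<^sup>T *\<^sub>v (a @\<^sub>v b @\<^sub>v d)
    = (Bt\<^sup>T *\<^sub>v a + Br\<^sup>T *\<^sub>v b) @\<^sub>v ((A * Bt)\<^sup>T *\<^sub>v a + Br\<^sup>T *\<^sub>v d)"
proof -
  have G1: "Bt @\<^sub>r Br @\<^sub>r 0\<^sub>m r n \<in> carrier_mat (t + (r + r)) n"
    and G2: "A * Bt @\<^sub>r 0\<^sub>m r n @\<^sub>r Br \<in> carrier_mat (t + (r + r)) n"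
    using Br Bt A by auto
  have c: "a @\<^sub>v b @\<^sub>v d \<in> carrier_vec (t + (r + r))" using a b d by simp
  have Brb: "Br\<^sup>T *\<^sub>v b \<in> carrier_vec n" and Brd: "Br\<^sup>T *\<^sub>v d \<in> carrier_vec n"
    using Br b d by auto
  show ?thesis
    using a b d unfolding steane_gen_eq_hcat[OF Br Bt A] hcat_transpose_mult_vec[OF G1 G2 c]
    by (simp add: transpose_append_rows_mult_append_vec zero_mat_mult_vec right_zero_vec[OF Brb]
        left_zero_vec[OF Brd] carrier_matD[OF Br] carrier_matD[OF Bt] carrier_matD[OF A])
qed

lemma lin_indep_rows_steane_gen:
  fixes Br Bt A :: "'a::field mat"
  assumes Br: "Br \<in> carrier_mat r n" and Bt: "Bt \<in> carrier_mat t n" and A: "A \<in> carrier_mat t t"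
    and indep_Br: "lin_indep_rows Br" and indep_Bt: "lin_indep_rows Bt"
    and disjoint: "rowspace Br \<inter> rowspace Bt = {0\<^sub>v n}"
  shows "lin_indep_rows (steane_gen Br Bt A)"
  unfolding lin_indep_rows_def
proof (intro ballI impI)
  have dims: "dim_row (steane_gen Br Bt A) = t + (r + r)" "dim_col (steane_gen Br Bt A) = n + n"
    unfolding steane_gen_def by (simp_all add: carrier_matD[OF Br] carrier_matD[OF Bt])
  fix c :: "'a vec" assume "c \<in> carrier_vec (dim_row (steane_gen Br Bt A))"
  then have c_carrier: "c \<in> carrier_vec (t + (r + r))" by (simp only: dims)
  define a b d where "a = vec_first c t" and "b = vec_first (vec_last c (r + r)) r"
    and "d = vec_last (vec_last c (r + r)) r"
  have a: "a \<in> carrier_vec t" and b: "b \<in> carrier_vec r" and d: "d \<in> carrier_vec r"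
    unfolding a_def b_def d_def by simp_all
  have c: "c = a @\<^sub>v b @\<^sub>v d"
    unfolding a_def b_def d_def using c_carrier by simp
  assume "(steane_gen Br Bt A)\<^sup>T *\<^sub>v c = 0\<^sub>v (dim_col (steane_gen Br Bt A))"
  then have "(Bt\<^sup>T *\<^sub>v a + Br\<^sup>T *\<^sub>v b) @\<^sub>v ((A * Bt)\<^sup>T *\<^sub>v a + Br\<^sup>T *\<^sub>v d) = 0\<^sub>v n @\<^sub>v 0\<^sub>v n"
    by (simp add: c dims steane_gen_transpose_mult_vec[OF Br Bt A a b d] zero_vec_add_eq_append)
  moreover have "Bt\<^sup>T *\<^sub>v a + Br\<^sup>T *\<^sub>v b \<in> carrier_vec n" using Br Bt a b by auto
  ultimately have "Bt\<^sup>T *\<^sub>v a + Br\<^sup>T *\<^sub>v b = 0\<^sub>v n" and Bd: "(A * Bt)\<^sup>T *\<^sub>v a + Br\<^sup>T *\<^sub>v d = 0\<^sub>v n"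
    by simp_all
  then have "(Bt @\<^sub>r Br)\<^sup>T *\<^sub>v (a @\<^sub>v b) = 0\<^sub>v n"
    using a b
    by (simp add: transpose_append_rows_mult_append_vec carrier_matD[OF Br] carrier_matD[OF Bt])
  moreover have "rowspace Bt \<inter> rowspace Br = {0\<^sub>v n}" using disjoint by blast
  ultimately have "a @\<^sub>v b = 0\<^sub>v (t + r)"
    using lin_indep_rows_append_rows[OF Bt Br indep_Bt indep_Br] Bt Br a b
    unfolding lin_indep_rows_def by auto
  then have a0: "a = 0\<^sub>v t" and b0: "b = 0\<^sub>v r"
    using a by (simp_all add: zero_vec_add_eq_append)
  then have "Br\<^sup>T *\<^sub>v d = 0\<^sub>v n"
    using Bd A Bt Br d by (simp add: mult_mat_vec_zero[of "(A * Bt)\<^sup>T" n t])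
  then have "d = 0\<^sub>v r" using indep_Br Br d unfolding lin_indep_rows_def by auto
  with a0 b0 show "c = 0\<^sub>v (dim_row (steane_gen Br Bt A))"
    unfolding c dims by (simp add: zero_vec_add_eq_append)
qed

lemma mem_sdual_steane_gen_iff:
  fixes Br Bt A :: "'a::field mat"
  assumes Br: "Br \<in> carrier_mat r n" and Bt: "Bt \<in> carrier_mat t n" and A: "A \<in> carrier_mat t t"
    and u: "u \<in> carrier_vec n" and v: "v \<in> carrier_vec n"
  shows "u @\<^sub>v v \<in> sdual n (rowspace (steane_gen Br Bt A)) \<longleftrightarrow>
    Bt *\<^sub>v v = A *\<^sub>v (Bt *\<^sub>v u) \<and> Br *\<^sub>v v = 0\<^sub>v r \<and> Br *\<^sub>v u = 0\<^sub>v r"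
proof -
  have ABt: "A * Bt \<in> carrier_mat t n" using A Bt by simp
  have G1: "Bt @\<^sub>r Br @\<^sub>r 0\<^sub>m r n \<in> carrier_mat (t + (r + r)) n"
    and G2: "A * Bt @\<^sub>r 0\<^sub>m r n @\<^sub>r Br \<in> carrier_mat (t + (r + r)) n"
    using Br Bt ABt by auto
  have "u @\<^sub>v v \<in> carrier_vec (2 * n)" using u v by (simp add: mult_2)
  then have "u @\<^sub>v v \<in> sdual n (rowspace (steane_gen Br Bt A)) \<longleftrightarrow>
      (Bt @\<^sub>r Br @\<^sub>r 0\<^sub>m r n) *\<^sub>v v = (A * Bt @\<^sub>r 0\<^sub>m r n @\<^sub>r Br) *\<^sub>v u"
    unfolding steane_gen_eq_hcat[OF Br Bt A] mem_sdual_rowspace_hcat_iff[OF G1 G2]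
    using u v by (simp add: vec_first_append vec_last_append)
  also have "\<dots> \<longleftrightarrow> Bt *\<^sub>v v = A *\<^sub>v (Bt *\<^sub>v u) \<and> Br *\<^sub>v v = 0\<^sub>v r \<and> Br *\<^sub>v u = 0\<^sub>v r"
    using Br Bt A u v
    by (simp add: mat_mult_append[OF Bt carrier_append_rows[OF Br zero_carrier_mat] v]
        mat_mult_append[OF Br zero_carrier_mat v]
        mat_mult_append[OF ABt carrier_append_rows[OF zero_carrier_mat Br] u]
        mat_mult_append[OF zero_carrier_mat Br u] zero_mat_mult_vec
        append_vec_eq[of _ t] append_vec_eq[of _ r] eq_commute[of "0\<^sub>v r"])
  finally show ?thesis .
qed

section \<open>Minimum distance\<close>

lemma hwt_eq_sum:
  "x \<in> carrier_vec n \<Longrightarrow> hwt x = (\<Sum>j<n. if x $ j \<noteq> 0 then 1 else 0)"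
  unfolding hwt_def by (simp add: sum.If_cases Int_def conj_commute lessThan_def)

lemma swt_append:
  assumes "u \<in> carrier_vec n" and "v \<in> carrier_vec n"
  shows "swt n (u @\<^sub>v v) = card {j. j < n \<and> (u $ j \<noteq> 0 \<or> v $ j \<noteq> 0)}"
  unfolding swt_def using assms by (intro arg_cong[where f = card]) auto

lemma sum_nonzero_pencil_entry:
  fixes a b :: "'a::{finite,field}"
  shows "(\<Sum>l\<in>UNIV. if a + l * b \<noteq> 0 then 1 else 0) + (if b \<noteq> 0 then 1 else 0)
       = card (UNIV :: 'a set) * (if a \<noteq> 0 \<or> b \<noteq> 0 then 1 else (0::nat))"
proof (cases "b = 0")
  case False
  then have "{l. a + l * b \<noteq> 0} = UNIV - {- a / b}"
    by (auto simp: field_simps add_eq_0_iff)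
  then have "(\<Sum>l\<in>UNIV. if a + l * b \<noteq> 0 then 1 else 0) = card (UNIV :: 'a set) - 1"
    by (simp add: sum.If_cases card_Diff_subset)
  then show ?thesis using False by (simp add: Suc_leI finite_UNIV_card_ge_0)
qed simp

lemma sum_hwt_pencil:
  fixes u v :: "'a::{finite,field} vec"
  assumes u: "u \<in> carrier_vec n" and v: "v \<in> carrier_vec n"
  shows "(\<Sum>l\<in>UNIV. hwt (v + l \<cdot>\<^sub>v u)) + hwt u
    = card (UNIV :: 'a set) * card {j. j < n \<and> (u $ j \<noteq> 0 \<or> v $ j \<noteq> 0)}"
proof -
  have "(\<Sum>l\<in>UNIV. hwt (v + l \<cdot>\<^sub>v u)) + hwt u
      = (\<Sum>j<n. (\<Sum>l\<in>UNIV. if v $ j + l * u $ j \<noteq> 0 then 1 else 0) + (if u $ j \<noteq> 0 then 1 else 0))"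
    using u v by (simp add: hwt_eq_sum[of _ n] sum.distrib sum.swap[of _ UNIV])
  also have "\<dots> = (\<Sum>j<n. card (UNIV :: 'a set) * (if u $ j \<noteq> 0 \<or> v $ j \<noteq> 0 then 1 else 0))"
    by (intro sum.cong refl) (auto simp: sum_nonzero_pencil_entry)
  also have "\<dots> = card (UNIV :: 'a set) * card {j. j < n \<and> (u $ j \<noteq> 0 \<or> v $ j \<noteq> 0)}"
    by (simp add: sum_distrib_left[symmetric] sum.If_cases Int_def lessThan_def conj_commute)
  finally show ?thesis .
qed

lemma dH_le_hwt: "x \<in> V \<Longrightarrow> x \<noteq> 0\<^sub>v n \<Longrightarrow> dH n V \<le> enat (hwt x)"
  unfolding dH_def by (rule INF_lower2[of x]) auto

lemma the_enat_dH_le_hwt: "x \<in> V \<Longrightarrow> x \<noteq> 0\<^sub>v n \<Longrightarrow> the_enat (dH n V) \<le> hwt x"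
  using dH_le_hwt[of x V n] by (cases "dH n V") auto

lemma nat_ceiling_le_if_mult_le:
  fixes q k s :: nat
  assumes q: "q \<ge> 1" and le: "(q + 1) * k \<le> q * s"
  shows "nat \<lceil>(1 + 1 / real q) * real k\<rceil> \<le> s"
proof -
  have "(1 + 1 / real q) * real k = real ((q + 1) * k) / real q" using q by (simp add: field_simps)
  also have "\<dots> \<le> real (q * s) / real q"
    using le by (intro divide_right_mono) (simp_all only: of_nat_le_iff)
  also have "\<dots> = real s" using q by simp
  finally show ?thesis by (simp add: nat_le_iff ceiling_le_iff)
qed

lemma pencil_weight_bound:
  fixes u v :: "'a::{finite,field} vec"
  assumes u: "u \<in> carrier_vec n" and v: "v \<in> carrier_vec n"
    and uV: "u \<in> V" and u0: "u \<noteq> 0\<^sub>v n" and pencil: "\<And>l. v + l \<cdot>\<^sub>v u \<in> V - {0\<^sub>v n}"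
  shows "nat \<lceil>(1 + 1 / real (card (UNIV :: 'a set))) * real (the_enat (dH n V))\<rceil>
    \<le> card {j. j < n \<and> (u $ j \<noteq> 0 \<or> v $ j \<noteq> 0)}"
proof (rule nat_ceiling_le_if_mult_le)
  show "card (UNIV :: 'a set) \<ge> 1" by (simp add: Suc_leI finite_UNIV_card_ge_0)
  have "the_enat (dH n V) \<le> hwt (v + l \<cdot>\<^sub>v u)" for l
    using pencil[of l] by (intro the_enat_dH_le_hwt) auto
  then have "(\<Sum>l\<in>(UNIV :: 'a set). the_enat (dH n V)) \<le> (\<Sum>l\<in>UNIV. hwt (v + l \<cdot>\<^sub>v u))"
    by (rule sum_mono)
  moreover have "the_enat (dH n V) \<le> hwt u" by (rule the_enat_dH_le_hwt[OF uV u0])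
  ultimately show "(card (UNIV :: 'a set) + 1) * the_enat (dH n V)
      \<le> card (UNIV :: 'a set) * card {j. j < n \<and> (u $ j \<noteq> 0 \<or> v $ j \<noteq> 0)}"
    using sum_hwt_pencil[OF u v] by (simp add: algebra_simps)
qed

lemma mem_edual_rowspaceI:
  fixes B :: "'a::field mat"
  assumes B: "B \<in> carrier_mat k n" and x: "x \<in> carrier_vec n" and Bx: "B *\<^sub>v x = 0\<^sub>v k"
  shows "x \<in> edual n (rowspace B)"
  unfolding edual_def rowspace_eq_image
proof (intro CollectI conjI ballI x)
  fix y assume "y \<in> (*\<^sub>v) B\<^sup>T ` carrier_vec (dim_row B)"
  then obtain c where c: "c \<in> carrier_vec k" and y: "y = B\<^sup>T *\<^sub>v c" using B by auto
  have "y \<bullet> x = c \<bullet> (B *\<^sub>v x)" unfolding y by (rule transpose_vec_mult_scalar[OF B x c])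
  then show "y \<bullet> x = 0" using Bx c by simp
qed

lemma mem_edual_sumI:
  assumes "x \<in> edual n V" and "x \<in> edual n W"
    and "V \<subseteq> carrier_vec n" and "W \<subseteq> carrier_vec n"
  shows "x \<in> edual n {v + w | v w. v \<in> V \<and> w \<in> W}"
  using assms unfolding edual_def by (fastforce simp: add_scalar_prod_distrib[of _ n])

lemma pencil_nonzero_if_no_eigenvalue:
  fixes A Bt :: "'a::field mat"
  assumes A: "A \<in> carrier_mat t t" and Bt: "Bt \<in> carrier_mat t n"
    and u: "u \<in> carrier_vec n" and v: "v \<in> carrier_vec n"
    and Btv: "Bt *\<^sub>v v = A *\<^sub>v (Bt *\<^sub>v u)" and Btu: "Bt *\<^sub>v u \<noteq> 0\<^sub>v t"
    and no_eigenvalue: "\<forall>e. \<not> eigenvalue A e"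
  shows "v + l \<cdot>\<^sub>v u \<noteq> 0\<^sub>v n"
proof
  assume "v + l \<cdot>\<^sub>v u = 0\<^sub>v n"
  then have "v = (- l) \<cdot>\<^sub>v u" using u v by (auto simp: vec_eq_iff add_eq_0_iff)
  then have "A *\<^sub>v (Bt *\<^sub>v u) = (- l) \<cdot>\<^sub>v (Bt *\<^sub>v u)"
    using Btv Bt u by (simp add: mult_mat_vec)
  then have "eigenvalue A (- l)"
    using A Bt Btu unfolding eigenvalue_def eigenvector_def
    by (auto intro!: exI[of _ "Bt *\<^sub>v u"] mult_mat_vec_carrier[OF Bt u])
  with no_eigenvalue show False by blast
qed

lemma swt_sdual_steane_gen_ge:
  fixes Br Bt A :: "'a::{finite,field} mat"
  assumes Br: "Br \<in> carrier_mat r n" and Bt: "Bt \<in> carrier_mat t n" and A: "A \<in> carrier_mat t t"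
    and no_eigenvalue: "\<forall>e. \<not> eigenvalue A e"
    and w: "w \<in> sdual n (rowspace (steane_gen Br Bt A))" and w0: "w \<noteq> 0\<^sub>v (2 * n)"
  shows "min (dH n (edual n {x + y | x y. x \<in> rowspace Br \<and> y \<in> rowspace Bt}))
      (enat (nat \<lceil>(1 + 1 / real (card (UNIV :: 'a set)))
        * real (the_enat (dH n (edual n (rowspace Br))))\<rceil>))
    \<le> enat (swt n w)"
proof -
  define u v where "u = vec_first w n" and "v = vec_last w n"
  have u: "u \<in> carrier_vec n" and v: "v \<in> carrier_vec n" unfolding u_def v_def by simp_all
  have w_eq: "w = u @\<^sub>v v"
    using w unfolding u_def v_def sdual_def by (simp add: mult_2)
  have Btv: "Bt *\<^sub>v v = A *\<^sub>v (Bt *\<^sub>v u)" and Brv: "Br *\<^sub>v v = 0\<^sub>v r" and Bru: "Br *\<^sub>v u = 0\<^sub>v r"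
    using w mem_sdual_steane_gen_iff[OF Br Bt A u v] unfolding w_eq by simp_all
  have swt_w: "swt n w = card {j. j < n \<and> (u $ j \<noteq> 0 \<or> v $ j \<noteq> 0)}"
    unfolding w_eq by (rule swt_append[OF u v])
  have hwt_le: "hwt x \<le> swt n w" if "x = u \<or> x = v" for x
    unfolding swt_w hwt_def using that u v by (intro card_mono) auto
  show ?thesis
  proof (cases "Bt *\<^sub>v u = 0\<^sub>v t")
    case True
    then have Btv0: "Bt *\<^sub>v v = 0\<^sub>v t" using Btv A by (simp add: mult_mat_vec_zero)
    have in_dual_C: "x \<in> edual n {x + y | x y. x \<in> rowspace Br \<and> y \<in> rowspace Bt}"
      if "x \<in> carrier_vec n" "Br *\<^sub>v x = 0\<^sub>v r" "Bt *\<^sub>v x = 0\<^sub>v t" for x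
      using that Br Bt
      by (intro mem_edual_sumI mem_edual_rowspaceI rowspace_subset_carrier)
    have "u \<noteq> 0\<^sub>v n \<or> v \<noteq> 0\<^sub>v n"
      using w0 unfolding w_eq by (auto simp: mult_2 zero_vec_add_eq_append)
    then obtain x where x: "x = u \<or> x = v" "x \<noteq> 0\<^sub>v n"
      and "x \<in> edual n {x + y | x y. x \<in> rowspace Br \<and> y \<in> rowspace Bt}"
      using in_dual_C[OF u Bru True] in_dual_C[OF v Brv Btv0] by blast
    then have "dH n (edual n {x + y | x y. x \<in> rowspace Br \<and> y \<in> rowspace Bt}) \<le> enat (hwt x)"
      by (intro dH_le_hwt)
    also have "\<dots> \<le> enat (swt n w)" using hwt_le[OF x(1)] by simp
    finally show ?thesis by (rule min.coboundedI1)
  next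
    case False
    have pencil: "v + l \<cdot>\<^sub>v u \<in> edual n (rowspace Br) - {0\<^sub>v n}" for l
    proof -
      have "Br *\<^sub>v (v + l \<cdot>\<^sub>v u) = Br *\<^sub>v v + l \<cdot>\<^sub>v (Br *\<^sub>v u)"
        using Br u v by (simp add: mult_add_distrib_mat_vec[of _ r n] mult_mat_vec[of _ r n])
      also have "\<dots> = 0\<^sub>v r" unfolding Brv Bru by (rule eq_vecI) auto
      finally have "v + l \<cdot>\<^sub>v u \<in> edual n (rowspace Br)"
        using u v by (intro mem_edual_rowspaceI[OF Br]) auto
      then show ?thesis
        using pencil_nonzero_if_no_eigenvalue[OF A Bt u v Btv False no_eigenvalue] by simp
    qed
    have u0: "u \<noteq> 0\<^sub>v n" using False Bt by (auto simp: mult_mat_vec_zero)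
    have "nat \<lceil>(1 + 1 / real (card (UNIV :: 'a set)))
        * real (the_enat (dH n (edual n (rowspace Br))))\<rceil> \<le> swt n w"
      unfolding swt_w
      by (rule pencil_weight_bound[OF u v mem_edual_rowspaceI[OF Br u Bru] u0 pencil])
    then show ?thesis by (intro min.coboundedI2) simp
  qed
qed

lemma ea_d_steane_gen_ge:
  fixes Br Bt A :: "'a::{finite,field} mat"
  assumes "Br \<in> carrier_mat r n" and "Bt \<in> carrier_mat t n" and "A \<in> carrier_mat t t"
    and "\<forall>e. \<not> eigenvalue A e"
  shows "min (dH n (edual n {x + y | x y. x \<in> rowspace Br \<and> y \<in> rowspace Bt}))
      (enat (nat \<lceil>(1 + 1 / real (card (UNIV :: 'a set)))
        * real (the_enat (dH n (edual n (rowspace Br))))\<rceil>))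
    \<le> ea_d n (rowspace (steane_gen Br Bt A))"
  unfolding ea_d_def ds_def by (rule INF_greatest) (use swt_sdual_steane_gen_ge[OF assms] in auto)

theorem theorem2p2:
  fixes Br Bt A :: "'a::{finite,field} mat" and n r t :: nat
  assumes "n \<ge> 1"
    and "Br \<in> carrier_mat r n" and "Bt \<in> carrier_mat t n"
    and "lin_indep_rows Br" and "lin_indep_rows Bt"
    and "rowspace Br \<inter> rowspace Bt = {0\<^sub>v n}"
    and "t \<ge> 2"
    and "A \<in> carrier_mat t t" and "invertible_mat A"
    and "\<forall>e. \<not> eigenvalue A e"
  shows
    "let C = {x + y | x y. x \<in> rowspace Br \<and> y \<in> rowspace Bt};
         D = rowspace (steane_gen Br Bt A);
         c' = real (mrank (steane_M Br Bt A)) / 2;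
         q = real (card (UNIV :: 'a set));
         del1 = dH n (edual n C);
         del2 = the_enat (dH n (edual n (rowspace Br)))
     in ea_c n D = c'
      \<and> ea_k n D = real n - 2 * real r - real t + c'
      \<and> ea_d n D \<ge> min del1 (enat (nat \<lceil>(1 + 1 / q) * real del2\<rceil>))"
proof -
  note Br = assms(2) and Bt = assms(3) and A = assms(8) and no_eigenvalue = assms(10)
  define G1 G2 where "G1 = Bt @\<^sub>r Br @\<^sub>r 0\<^sub>m r n" and "G2 = A * Bt @\<^sub>r 0\<^sub>m r n @\<^sub>r Br"
  have G1: "G1 \<in> carrier_mat (t + (r + r)) n" and G2: "G2 \<in> carrier_mat (t + (r + r)) n"
    unfolding G1_def G2_def using Br Bt A by auto
  have D: "steane_gen Br Bt A = hcat G1 G2"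
    unfolding G1_def G2_def by (rule steane_gen_eq_hcat[OF Br Bt A])
  have M: "steane_M Br Bt A = G1 * G2\<^sup>T - G2 * G1\<^sup>T"
    unfolding G1_def G2_def by (rule steane_M_eq_symplectic_gram[OF Br Bt A])
  have indep: "lin_indep_rows (hcat G1 G2)"
    unfolding D[symmetric] using assms by (intro lin_indep_rows_steane_gen[OF Br Bt A])
  show ?thesis
    unfolding Let_def D M
    using ea_c_rowspace_hcat[OF G1 G2 indep] ea_k_rowspace_hcat[OF G1 G2 indep]
      ea_d_steane_gen_ge[OF Br Bt A no_eigenvalue]
    by (simp add: D)
qed

end
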